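(* Let $f:\mathbb{R}^d\to\mathbb{R}$ be twice continuously differentiable with minimizer $x_*$, and suppose there are constants $\mu,L,M>0$ such that: $f$ is strongly convex with parameter $\mu$; $\|\nabla f(x)-\nabla f(y)\|\le L\|x-y\|$ for all $x,y\in\mathbb{R}^d$; and $\|\nabla^2 f(x)-\nabla^2 f(x_* )\|\le M\|x-x_*\|$ for all $x\in\mathbb{R}^d$. Let $\{x_k\}_{k\ge0}$ be the iterates generated by the BFGS method with exact line search from an arbitrary initial point $x_0\in\mathbb{R}^d$ and an arbitrary symmetric positive definite initial matrix $B_0\in\mathbb{R}^{d\times d}$, and assume $x_k\ne x_*$ for all $k\ge0$. Set $\kappa=L/\mu$, $C_0=\frac{2M}{\mu^{3/2}}\sqrt{2(f(x_0)-f(x_* ))}$, $\bar B_0=\frac1L B_0$, and $\Psi(A)=\mathrm{Tr}(A)-\log\det(A)-d$. Then: (i) for every $k\ge1$, $$\frac{f(x_k)-f(x_* )}{f(x_0)-f(x_* )}\le\left(1-e^{-\frac{\Psi(\bar B_0)}{k}}\,\frac1\kappa\max\left\{\frac{2}{1+\sqrt\kappa},\frac1{1+C_0}\right\}\right)^k;$$ (ii) for every $k\ge1$ with $k\ge\Psi(\bar B_0)$, $$\frac{f(x_k)-f(x_* )}{f(x_0)-f(x_* )}\le\left(1-\frac1{3\kappa}\max\left\{\frac{2}{1+\sqrt\kappa},\frac1{1+C_0}\right\}\right)^k;$$ (iii) for every $k\ge1$ with $k\ge(1+C_0)\Psi(\bar B_0)+3C_0\kappa\min\{2(1+C_0),\,1+\sqrt\kappa\}$,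 $$\frac{f(x_k)-f(x_* )}{f(x_0)-f(x_* )}\le\left(1-\frac1{3\kappa}\right)^k.$$
   Context: $\|\cdot\|$ is the Euclidean norm of vectors and the spectral norm of matrices; $\log$ is the natural logarithm. Since $f$ is twice differentiable, strong convexity with parameter $\mu$ and $L$-Lipschitz gradient mean $\mu I\preceq\nabla^2 f(x)\preceq LI$ for all $x$. BFGS method with exact line search: given $x_0\in\mathbb{R}^d$ and symmetric positive definite $B_0$, for $k\ge0$ put $g_k=\nabla f(x_k)$, $d_k=-B_k^{-1}g_k$, $\eta_k=\arg\min_{\eta\ge0}f(x_k+\eta d_k)$, $x_{k+1}=x_k+\eta_kd_k$, $s_k=x_{k+1}-x_k$, $y_k=\nabla f(x_{k+1})-\nabla f(x_k)$, and $$B_{k+1}=B_k-\frac{B_ks_ks_k^\top B_k}{s_k^\top B_ks_k}+\frac{y_ky_k^\top}{s_k^\top y_k}.$$ All $B_k$ are then symmetric positive definite. The standing assumption that $x_k\neq x_*$ for all $k$ ensures that all quantities are well defined. *)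

theory Defs
  imports "HOL-Analysis.Analysis"
begin

definition gradient :: "('a::real_inner \<Rightarrow> real) \<Rightarrow> 'a \<Rightarrow> 'a" where
  "gradient f x = (THE D. GDERIV f x :> D)"

lemma gradient_eqI:
  assumes "GDERIV f x :> D"
  shows "gradient f x = D"
  unfolding gradient_def
proof (rule the_equality)
  show "GDERIV f x :> D" by fact
next
  fix E assume "GDERIV f x :> E"
  then have "(\<lambda>h. inner h E) = (\<lambda>h. inner h D)"
    using assms unfolding gderiv_def by (rule has_derivative_unique)
  then show "E = D"
    by (metis vector_eq_rdot inner_commute)
qed

definition hessian :: "(real^'n \<Rightarrow> real) \<Rightarrow> real^'n \<Rightarrow> real^'n^'n" where
  "hessian f x = jacobian (gradient f) (at x)"

definition twice_continuously_differentiable :: "(real^'n \<Rightarrow> real) \<Rightarrow> bool" where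
  "twice_continuously_differentiable f \<longleftrightarrow>
     (\<forall>x. f differentiable (at x)) \<and>
     (\<forall>x. gradient f differentiable (at x)) \<and>
     continuous_on UNIV (hessian f)"

definition strongly_convex :: "real \<Rightarrow> ('a::real_normed_vector \<Rightarrow> real) \<Rightarrow> bool" where
  "strongly_convex \<mu> f \<longleftrightarrow>
     (\<forall>x y. \<forall>t\<in>{0..1}.
        f ((1 - t) *\<^sub>R x + t *\<^sub>R y)
          \<le> (1 - t) * f x + t * f y - \<mu> / 2 * t * (1 - t) * (norm (x - y))\<^sup>2)"

(* The instance of norm on matrices is the Frobenius norm, so the spectral norm is written
   as an operator norm. *)
definition spectral_norm :: "real^'n^'m \<Rightarrow> real" where
  "spectral_norm A = onorm ((*v) A)"

definition sym_pos_def :: "real^'n^'n \<Rightarrow> bool" where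
  "sym_pos_def A \<longleftrightarrow> transpose A = A \<and> (\<forall>v. v \<noteq> 0 \<longrightarrow> v \<bullet> (A *v v) > 0)"

definition outer_prod :: "real^'n \<Rightarrow> real^'m \<Rightarrow> real^'m^'n" where
  "outer_prod u v = (\<chi> i j. u $ i * v $ j)"

definition bfgs_update :: "real^'n^'n \<Rightarrow> real^'n \<Rightarrow> real^'n \<Rightarrow> real^'n^'n" where
  "bfgs_update B s y =
     B - (1 / (s \<bullet> (B *v s))) *\<^sub>R (B ** outer_prod s s ** B)
       + (1 / (s \<bullet> y)) *\<^sub>R outer_prod y y"

(* The sequences x and B are produced by BFGS from x 0 and B 0; symmetry and positive
   definiteness of B 0 is a separate hypothesis. *)
definition bfgs_exact_line_search ::
    "(real^'n \<Rightarrow> real) \<Rightarrow> (nat \<Rightarrow> real^'n) \<Rightarrow> (nat \<Rightarrow> real^'n^'n) \<Rightarrow> bool" where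
  "bfgs_exact_line_search f x B \<longleftrightarrow>
     (\<forall>k. let d = - (matrix_inv (B k) *v gradient f (x k));
              s = x (Suc k) - x k;
              y = gradient f (x (Suc k)) - gradient f (x k)
          in (\<exists>\<eta>. is_arg_min (\<lambda>\<eta>. f (x k + \<eta> *\<^sub>R d)) (\<lambda>\<eta>. \<eta> \<ge> 0) \<eta> \<and>
                   x (Suc k) = x k + \<eta> *\<^sub>R d) \<and>
             B (Suc k) = bfgs_update (B k) s y)"

definition Psi :: "real^'n^'n \<Rightarrow> real" where
  "Psi A = trace A - ln (det A) - real CARD('n)"

end

theory Submission
  imports Defs
begin

text \<open>
  Everything rests on one potential, \<open>Psi\<close>, which measures how far a positive definite matrix is
  from the identity, evaluated at \<open>B k\<close> divided by \<open>L\<close>. A BFGS update changes trace and determinant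
  by explicit amounts, so \<open>Psi\<close> changes by an explicit amount too
  (\<open>Psi_bfgs_update_le\<close>). Since gradients are \<open>L\<close>-Lipschitz, cocoercivity makes the term in
  \<open>y\<close> harmless, and what remains says that \<open>Psi\<close> grows in step \<open>i\<close> by at most the logarithm of
  the scale-free number \<open>alignment i = L (- g \<bullet> s) / |g|\<^sup>2\<close>, where \<open>g\<close> is the gradient at the
  \<open>i\<close>-th iterate and \<open>s\<close> the step from it. Because \<open>Psi\<close> is never negative, the product of the first
  \<open>k\<close> alignments is at least \<open>exp (- Psi B0bar)\<close> for every \<open>k\<close>
  (\<open>prod_alignment_ge\<close>): single steps can be badly aligned with the gradient, but not on
  geometric average.

  A well aligned step makes progress. Along the step, \<open>f\<close> is a function of one variable whose second
  derivative lies in some interval \<open>[lo, hi]\<close> and whose derivative vanishes at the end, because the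
  line search is exact; such a function drops by at least \<open>1 / (1 + sqrt (hi / lo))\<close> times
  \<open>- g \<bullet> s\<close> (\<open>decrease_to_stationary_point\<close>). The interval may be the global one given by \<open>\<mu>\<close> and
  \<open>L\<close>, or one around the Hessian at the minimizer that shrinks as the iterates converge; the two
  choices give the two terms of the maximum in the statement. Comparing \<open>|g|\<^sup>2\<close> with the optimality
  gap through strong convexity yields a contraction by \<open>1 - gain i * alignment i\<close>
  (\<open>contraction\<close>).

  The product of these contraction factors is bounded with the inequality of arithmetic and geometric
  means, applied once to the factors and once to the numbers \<open>gain i * alignment i\<close>
  (\<open>prod_one_minus_le\<close>). This reduces each of the three claims to a lower bound for the product of the
  gains (\<open>rate\<close>). For the first two, every gain is at least the first one. For the third,
  the gain at step \<open>i\<close> is at least \<open>exp (- C i) / \<kappa>\<close>, with \<open>C i\<close> proportional to the square root of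
  the optimality gap, and the second claim shows that these numbers have a bounded sum
  (\<open>sum_C_le\<close>).
\<close>

section \<open>The BFGS update and the potential\<close>

lemma outer_prod_mult_vec [simp]: "outer_prod u v *v z = (v \<bullet> z) *\<^sub>R u"
  by (simp add: outer_prod_def matrix_vector_mult_def vec_eq_iff inner_vec_def sum_distrib_left mult_ac)

lemma trace_outer_prod: "trace (outer_prod u v) = u \<bullet> v"
  by (simp add: outer_prod_def trace_def inner_vec_def)

lemma trace_scaleR: "trace (c *\<^sub>R A) = c * trace (A :: real^'n^'n)"
  by (simp add: trace_def sum_distrib_left)

text \<open>
  Adding a multiple of \<open>u\<close> to column \<open>k\<close> of the identity changes one column only, which is the
  situation of Cramer's rule.
\<close>

lemma det_mat_plus_outer_axis:
  "det (mat 1 + outer_prod u (axis k c)) = 1 + c * (u $ k)"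
  for u :: "real^'n"
proof -
  have "mat 1 + outer_prod u (axis k c) =
      (\<chi> i j. if j = k then ((mat 1 :: real^'n^'n) *v (axis k 1 + c *\<^sub>R u)) $ i
              else (mat 1 :: real^'n^'n) $ i $ j)"
    unfolding matrix_vector_mul_lid
    by (auto simp: vec_eq_iff outer_prod_def axis_def mat_def)
  then show ?thesis
    by (simp only: cramer_lemma) (simp add: axis_def)
qed

text \<open>
  The matrix determinant lemma. Both sides are unchanged when \<open>u\<close> and \<open>v\<close> are rotated together, so
  \<open>v\<close> may be assumed to point along a coordinate axis.
\<close>

lemma det_mat_plus_outer_prod: "det (mat 1 + outer_prod u v) = 1 + u \<bullet> v"
  for u v :: "real^'n"
proof (cases "v = 0")
  case True
  then have "outer_prod u v = 0"
    by (simp add: outer_prod_def vec_eq_iff)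
  with True show ?thesis by simp
next
  case False
  then have "norm (v /\<^sub>R norm v) = 1" by simp
  then obtain Q :: "real^'n^'n" and k where Q: "orthogonal_matrix Q"
    and Qk: "Q *v axis k 1 = v /\<^sub>R norm v"
    by (metis orthogonal_matrix_exists_basis)
  have QtQ: "transpose Q ** Q = mat 1"
    using Q by (auto simp: orthogonal_matrix_def)
  have eq: "v = Q *v axis k (norm v)"
  proof -
    have "axis k (norm v) = norm v *\<^sub>R axis k (1::real)"
      by (simp add: vec_eq_iff axis_def)
    then show ?thesis using Qk False by (simp add: matrix_vector_mult_scaleR)
  qed
  have adj: "a \<bullet> (Q *v b) = (transpose Q *v a) \<bullet> b" for a b
    by (simp add: dot_lmul_matrix)
  have "mat 1 + outer_prod (transpose Q *v u) (axis k (norm v))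
      = transpose Q ** (mat 1 + outer_prod u v) ** Q"
    unfolding matrix_eq
  proof
    fix z
    have "v \<bullet> (Q *v z) = axis k (norm v) \<bullet> z"
      by (subst eq, subst adj) (simp add: matrix_vector_mul_assoc QtQ del: transpose_matrix_vector)
    then show "(mat 1 + outer_prod (transpose Q *v u) (axis k (norm v))) *v z
      = (transpose Q ** (mat 1 + outer_prod u v) ** Q) *v z"
      by (simp add: matrix_vector_mul_assoc[symmetric] matrix_vector_mult_add_rdistrib
          matrix_vector_right_distrib matrix_vector_mult_scaleR del: transpose_matrix_vector)
         (simp add: matrix_vector_mul_assoc QtQ del: transpose_matrix_vector)
  qed
  then have "det (mat 1 + outer_prod (transpose Q *v u) (axis k (norm v)))
      = det (transpose Q ** Q) * det (mat 1 + outer_prod u v)"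
    by (simp add: det_mul)
  then have "det (mat 1 + outer_prod u v) = 1 + norm v * (transpose Q *v u) $ k"
    by (simp only: QtQ det_mat_plus_outer_axis) simp
  also have "norm v * (transpose Q *v u) $ k = (transpose Q *v u) \<bullet> axis k (norm v)"
    by (simp only: inner_axis) simp
  also have "\<dots> = u \<bullet> v"
    using adj eq by metis
  finally show ?thesis .
qed

lemma sym_pos_def_sym: "sym_pos_def A \<Longrightarrow> u \<bullet> (A *v v) = (A *v u) \<bullet> v"
  by (metis sym_pos_def_def dot_lmul_matrix transpose_matrix_vector)

lemma sym_pos_def_pos: "sym_pos_def A \<Longrightarrow> v \<noteq> 0 \<Longrightarrow> v \<bullet> (A *v v) > 0"
  by (simp add: sym_pos_def_def)

lemma bfgs_update_mult_vec:
  assumes "sym_pos_def A"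
  shows "bfgs_update A s y *v z =
    A *v z - ((A *v s) \<bullet> z / (s \<bullet> (A *v s))) *\<^sub>R (A *v s) + ((y \<bullet> z) / (s \<bullet> y)) *\<^sub>R y"
  using sym_pos_def_sym[OF assms, of s z]
  by (simp add: bfgs_update_def matrix_vector_mult_add_rdistrib matrix_vector_mult_diff_rdistrib
      scaleR_matrix_vector_assoc[symmetric] matrix_vector_mul_assoc[symmetric]
      matrix_vector_mult_scaleR)

lemma bfgs_update_secant:
  assumes "sym_pos_def A" "s \<bullet> y > 0"
  shows "bfgs_update A s y *v s = y"
proof -
  have "s \<noteq> 0" using assms(2) by auto
  with assms sym_pos_def_pos[of A s] show ?thesis
    by (simp add: bfgs_update_mult_vec inner_commute)
qed

text \<open>
  The product form of the update: it is a congruence of \<open>A\<close> by a rank-one perturbation of the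
  identity. This one identity shows that definiteness is kept and gives the determinant without
  inverting \<open>A\<close>.
\<close>

lemma bfgs_update_congruence:
  fixes A :: "real^'n^'n"
  assumes A: "sym_pos_def A" and sy: "s \<bullet> y > 0"
  defines "w \<equiv> (1 / sqrt ((s \<bullet> (A *v s)) * (s \<bullet> y))) *\<^sub>R y - (1 / (s \<bullet> (A *v s))) *\<^sub>R (A *v s)"
  shows "bfgs_update A s y = transpose (mat 1 + outer_prod s w) ** A ** (mat 1 + outer_prod s w)"
    and "det (mat 1 + outer_prod s w) = sqrt ((s \<bullet> y) / (s \<bullet> (A *v s)))"
proof -
  define b where "b = s \<bullet> (A *v s)"
  define c where "c = s \<bullet> y"
  define a where "a = 1 / sqrt (b * c)"
  have "s \<noteq> 0" using sy by auto
  then have b: "b > 0" and c: "c > 0"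
    using A sy by (auto simp: b_def c_def sym_pos_def_def)
  \<comment> \<open>In \<open>w\<close>, the weight of \<open>A s\<close> makes the mixed terms in \<open>y\<close> and \<open>A s\<close> cancel, and the weight \<open>a\<close> gives the term in \<open>y\<close> alone its coefficient \<open>1 / c\<close>.\<close>
  have aa: "a * (a * b) = 1 / c"
    using b c by (simp add: a_def real_sqrt_mult field_simps)
  have w: "w = a *\<^sub>R y - (1 / b) *\<^sub>R (A *v s)"
    by (simp add: w_def a_def b_def c_def)
  have tr: "transpose (mat 1 + outer_prod s w) = mat 1 + outer_prod w s"
    by (simp add: transpose_def outer_prod_def mat_def vec_eq_iff mult.commute)
  show "bfgs_update A s y = transpose (mat 1 + outer_prod s w) ** A ** (mat 1 + outer_prod s w)"
    unfolding tr matrix_eq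
  proof
    fix z
    define m where "m = y \<bullet> z"
    define n where "n = (A *v s) \<bullet> z"
    have wz: "w \<bullet> z = a * m - n / b"
      by (simp add: w m_def n_def inner_diff_left)
    have "s \<bullet> (A *v z + (w \<bullet> z) *\<^sub>R (A *v s)) = n + (a * m - n / b) * b"
      by (simp add: inner_add_right wz b_def[symmetric] n_def sym_pos_def_sym[OF A, of s z])
    also have "\<dots> = a * b * m"
      using b by (simp add: field_simps)
    finally have e: "s \<bullet> (A *v z + (w \<bullet> z) *\<^sub>R (A *v s)) = a * b * m" .
    have "((mat 1 + outer_prod w s) ** A ** (mat 1 + outer_prod s w)) *v z
      = (A *v z + (w \<bullet> z) *\<^sub>R (A *v s)) + (s \<bullet> (A *v z + (w \<bullet> z) *\<^sub>R (A *v s))) *\<^sub>R w"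
      by (simp add: matrix_vector_mul_assoc[symmetric] matrix_vector_mult_add_rdistrib
          matrix_vector_right_distrib matrix_vector_mult_scaleR inner_add_right scaleR_add_left
          scaleR_add_right add_ac)
    also have "\<dots> = A *v z + (a * m - n / b) *\<^sub>R (A *v s) + (a * b * m) *\<^sub>R w"
      unfolding e unfolding wz ..
    also have "\<dots> = A *v z - (n / b) *\<^sub>R (A *v s) + (a * (a * b) * m) *\<^sub>R y"
      using b by (simp add: w scaleR_diff_right scaleR_diff_left mult_ac)
    also have "\<dots> = bfgs_update A s y *v z"
      by (simp only: bfgs_update_mult_vec[OF A] aa n_def[symmetric] m_def[symmetric]
          b_def[symmetric] c_def[symmetric]) simp
    finally show "bfgs_update A s y *v z =
      ((mat 1 + outer_prod w s) ** A ** (mat 1 + outer_prod s w)) *v z" ..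
  qed
  have "det (mat 1 + outer_prod s w) = 1 + (a * c - 1)"
    using b by (simp add: det_mat_plus_outer_prod w inner_diff_right c_def b_def)
  also have "\<dots> = sqrt (c / b)"
    using b c by (simp add: a_def real_sqrt_mult real_sqrt_divide field_simps)
  finally show "det (mat 1 + outer_prod s w) = sqrt ((s \<bullet> y) / (s \<bullet> (A *v s)))"
    by (simp add: b_def c_def)
qed

lemma det_bfgs_update:
  fixes A :: "real^'n^'n"
  assumes "sym_pos_def A" "s \<bullet> y > 0"
  shows "det (bfgs_update A s y) = det A * ((s \<bullet> y) / (s \<bullet> (A *v s)))"
proof -
  have "s \<noteq> 0" using assms(2) by auto
  then have "s \<bullet> (A *v s) > 0" using assms(1) by (simp add: sym_pos_def_def)
  with assms(2) have "sqrt ((s \<bullet> y) / (s \<bullet> (A *v s))) * sqrt ((s \<bullet> y) / (s \<bullet> (A *v s)))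
      = (s \<bullet> y) / (s \<bullet> (A *v s))"
    by simp
  then show ?thesis
    unfolding bfgs_update_congruence(1)[OF assms] det_mul det_transpose bfgs_update_congruence(2)[OF assms]
    by (metis mult.assoc mult.commute)
qed

lemma sym_pos_def_bfgs_update:
  fixes A :: "real^'n^'n"
  assumes A: "sym_pos_def A" and sy: "s \<bullet> y > 0"
  shows "sym_pos_def (bfgs_update A s y)"
proof -
  obtain N where eq: "bfgs_update A s y = transpose N ** A ** N"
    and N: "det N = sqrt ((s \<bullet> y) / (s \<bullet> (A *v s)))"
    using bfgs_update_congruence[OF assms] by blast
  have "s \<noteq> 0" using sy by auto
  then have "det N \<noteq> 0"
    using N sy sym_pos_def_pos[OF A, of s] by simp
  then have "inj ((*v) N)"
    by (metis invertible_det_nz matrix_left_invertible_injective invertible_left_inverse)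
  then have "N *v v \<noteq> 0" if "v \<noteq> 0" for v
    using that by (metis injD matrix_vector_mult_0_right)
  moreover have "v \<bullet> ((transpose N ** A ** N) *v v) = (N *v v) \<bullet> (A *v (N *v v))" for v
  proof -
    have "v \<bullet> (transpose N *v a) = (N *v v) \<bullet> a" for a
      by (metis dot_lmul_matrix inner_commute transpose_matrix_vector)
    then show ?thesis
      by (simp only: matrix_vector_mul_assoc[symmetric])
  qed
  ultimately show ?thesis
    using A unfolding sym_pos_def_def eq
    by (simp add: matrix_transpose_mul matrix_mul_assoc)
qed

lemma trace_bfgs_update:
  fixes A :: "real^'n^'n"
  assumes "sym_pos_def A"
  shows "trace (bfgs_update A s y)
    = trace A - (norm (A *v s))\<^sup>2 / (s \<bullet> (A *v s)) + (norm y)\<^sup>2 / (s \<bullet> y)"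
proof -
  have "A ** outer_prod s s ** A = outer_prod (A *v s) (A *v s)"
    unfolding matrix_eq
    by (auto simp add: matrix_vector_mul_assoc[symmetric] matrix_vector_mult_scaleR
        sym_pos_def_sym[OF assms])
  then show ?thesis
    by (simp add: bfgs_update_def trace_add trace_sub trace_scaleR trace_outer_prod power2_norm_eq_inner)
qed

text \<open>
  Minimizing half the squared norm, for which \<open>y = s\<close>, along the coordinate directions turns any
  positive definite matrix into the identity: once \<open>A\<close> fixes a coordinate vector, updates along the other coordinates
  leave that vector fixed. Read backwards, this is an induction rule for positive definite
  matrices that replaces diagonalization below.
\<close>

lemma sym_pos_def_update_induct [consumes 1, case_names identity update]:
  fixes A :: "real^'n^'n"
  assumes A: "sym_pos_def A" and "P (mat 1)"
    and step: "\<And>A i. sym_pos_def A \<Longrightarrow> P (bfgs_update A (axis i 1) (axis i 1)) \<Longrightarrow> P A"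
  shows "P A"
proof -
  \<comment> \<open>The set \<open>I\<close> holds the coordinates that have not been treated yet.\<close>
  have "P A" if "finite I" "sym_pos_def A" "\<forall>j. j \<notin> I \<longrightarrow> A *v axis j 1 = axis j 1" for I A
    using that
  proof (induction I arbitrary: A rule: finite_induct)
    case empty
    then have "column j A = axis j 1" for j
      by (simp add: matrix_vector_mult_basis)
    then have "A $ i $ j = axis j 1 $ i" for i j
      by (metis column_def vec_lambda_beta)
    then have "A = mat 1"
      by (simp add: vec_eq_iff mat_def axis_def)
    then show ?case using assms(2) by simp
  next
    case (insert i I)
    let ?e = "axis i 1 :: real^'n"
    have e: "?e \<bullet> ?e > 0" by simp
    have "bfgs_update A ?e ?e *v axis j 1 = axis j 1" if "j \<notin> I" for j
    proof (cases "j = i")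
      case True
      then show ?thesis using bfgs_update_secant[OF insert.prems(1) e] by simp
    next
      case False
      then have j: "A *v axis j 1 = axis j 1" using insert.prems(2) that by simp
      have "(A *v ?e) \<bullet> axis j 1 = ?e \<bullet> axis j 1"
        using sym_pos_def_sym[OF insert.prems(1), of ?e "axis j 1"] j by simp
      moreover have "?e \<bullet> axis j 1 = 0" using False by (simp add: inner_axis_axis)
      ultimately show ?thesis
        by (simp add: bfgs_update_mult_vec[OF insert.prems(1)] j)
    qed
    then have "P (bfgs_update A ?e ?e)"
      using insert.IH[OF sym_pos_def_bfgs_update[OF insert.prems(1) e]] by blast
    then show ?case by (rule step[OF insert.prems(1)])
  qed
  from this[of UNIV A] A show ?thesis by simp
qed

lemma det_pos_if_sym_pos_def: "sym_pos_def A \<Longrightarrow> det A > 0"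
proof (induction rule: sym_pos_def_update_induct)
  case (update A i)
  have "axis i 1 \<bullet> (A *v axis i 1) > 0"
    by (rule sym_pos_def_pos[OF update(1)]) (simp add: axis_eq_0_iff)
  with update show ?case
    by (simp add: det_bfgs_update zero_less_divide_iff)
qed simp

text \<open>
  The trace loses \<open>|A s|\<^sup>2 / (s \<bullet> A s)\<close>, a number \<open>q\<close> that is traded for its logarithm by
  \<open>ln q \<le> q - 1\<close>. What is then left inside the logarithm is the squared cosine of the angle between
  \<open>s\<close> and \<open>A s\<close>, divided by the curvature \<open>(s \<bullet> y) / |s|\<^sup>2\<close>.
\<close>

lemma Psi_bfgs_update_le:
  fixes A :: "real^'n^'n"
  assumes A: "sym_pos_def A" and sy: "s \<bullet> y > 0"
  shows "Psi (bfgs_update A s y) \<le> Psi A + ((norm y)\<^sup>2 / (s \<bullet> y) - 1)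
    + ln ((s \<bullet> (A *v s))\<^sup>2 / ((norm (A *v s))\<^sup>2 * (s \<bullet> y)))"
proof -
  define b where "b = s \<bullet> (A *v s)"
  define c where "c = s \<bullet> y"
  define n where "n = (norm (A *v s))\<^sup>2"
  have "s \<noteq> 0" using sy by auto
  then have b: "b > 0" using sym_pos_def_pos[OF A] by (simp add: b_def)
  then have n: "n > 0" by (auto simp: n_def b_def)
  have c: "c > 0" using sy by (simp add: c_def)
  have "ln (n / b) \<le> n / b - 1"
    using b n by (intro ln_le_minus_one) simp
  moreover have "ln (b\<^sup>2 / (n * c)) = - ln (n / b) - ln (c / b)"
    using b n c by (simp add: ln_div ln_mult power2_eq_square)
  moreover have "ln (det A * (c / b)) = ln (det A) + ln (c / b)"
    using b c det_pos_if_sym_pos_def[OF A] by (simp add: ln_mult_pos ln_div)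
  ultimately show ?thesis
    unfolding Psi_def trace_bfgs_update[OF A] det_bfgs_update[OF A sy]
      b_def[symmetric] c_def[symmetric] n_def[symmetric] by linarith
qed

text \<open>
  For \<open>y = s\<close> a unit vector, the bound on the growth of \<open>Psi\<close> is the logarithm of a squared cosine, so
  the updates that lead to the identity never increase \<open>Psi\<close>; and \<open>Psi\<close> vanishes at the
  identity.
\<close>

lemma Psi_nonneg: "sym_pos_def A \<Longrightarrow> Psi A \<ge> 0" for A :: "real^'n^'n"
proof (induction rule: sym_pos_def_update_induct)
  case identity
  then show ?case by (simp add: Psi_def trace_I)
next
  case (update A i)
  let ?e = "axis i 1 :: real^'n"
  have e1: "norm ?e = 1" and ee: "?e \<bullet> ?e = 1" by (simp_all add: inner_axis)
  have "0 < ?e \<bullet> (A *v ?e)"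
    using sym_pos_def_pos[OF update(1), of ?e] by (simp add: axis_eq_0_iff)
  moreover have "?e \<bullet> (A *v ?e) \<le> norm (A *v ?e)"
    using norm_cauchy_schwarz[of ?e "A *v ?e"] e1 by simp
  ultimately have "ln ((?e \<bullet> (A *v ?e))\<^sup>2 / ((norm (A *v ?e))\<^sup>2 * (?e \<bullet> ?e))) \<le> 0"
    by (subst ln_le_zero_iff) (auto simp: ee divide_le_eq intro!: power_mono divide_pos_pos)
  with Psi_bfgs_update_le[OF update(1), of ?e ?e] update(2) show ?case
    by (simp add: ee e1)
qed

lemma sym_pos_def_mult_inverse:
  assumes "sym_pos_def A"
  shows "A *v (matrix_inv A *v v) = v"
proof -
  have "invertible A" using det_pos_if_sym_pos_def[OF assms] by (simp add: invertible_det_nz)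
  then have "A ** matrix_inv A = mat 1"
    unfolding invertible_def matrix_inv_def by (rule someI2_ex) blast
  then show ?thesis by (simp add: matrix_vector_mul_assoc)
qed

lemma sym_pos_def_scaleR: "sym_pos_def A \<Longrightarrow> c > 0 \<Longrightarrow> sym_pos_def (c *\<^sub>R A)"
  by (simp add: sym_pos_def_def scaleR_matrix_vector_assoc[symmetric] transpose_scalar)

text \<open>
  The rescaled matrices are again produced by BFGS, from the rescaled gradient differences; so
  scaling costs nothing in the estimates of \<open>Psi\<close>.
\<close>

lemma bfgs_update_scaleR:
  assumes "sym_pos_def A" "c > 0"
  shows "bfgs_update (c *\<^sub>R A) s (c *\<^sub>R y) = c *\<^sub>R bfgs_update A s y"
  unfolding matrix_eq
proof
  fix z
  show "bfgs_update (c *\<^sub>R A) s (c *\<^sub>R y) *v z = (c *\<^sub>R bfgs_update A s y) *v z"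
    using assms
    by (simp add: bfgs_update_mult_vec sym_pos_def_scaleR scaleR_matrix_vector_assoc[symmetric]
        scaleR_add_right scaleR_diff_right mult.commute)
qed

section \<open>Functions of one variable\<close>

lemma second_order_upper_bound:
  fixes \<phi> \<phi>' \<phi>'' :: "real \<Rightarrow> real"
  assumes "a < b"
    and "\<And>t. t \<in> {a..b} \<Longrightarrow> (\<phi> has_real_derivative \<phi>' t) (at t)"
    and "\<And>t. t \<in> {a..b} \<Longrightarrow> (\<phi>' has_real_derivative \<phi>'' t) (at t)"
    and "\<And>t. t \<in> {a..b} \<Longrightarrow> \<phi>'' t \<le> K"
  shows "\<phi> b \<le> \<phi> a + \<phi>' a * (b - a) + K / 2 * (b - a)\<^sup>2"
proof -
  define D where "D m = (if m = 0 then \<phi> else if m = 1 then \<phi>' else \<phi>'')" for m :: nat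
  have "\<exists>t::real. a < t \<and> t < b \<and>
    \<phi> b = (\<Sum>m<2. (D m a / fact m) * (b - a)^m) + (D 2 t / fact 2) * (b - a)^2"
    by (rule Taylor_up[where a = a]) (use assms in \<open>auto simp: D_def less_2_cases_iff\<close>)
  then obtain t where t: "a < t" "t < b"
    and eq: "\<phi> b = \<phi> a + \<phi>' a * (b - a) + \<phi>'' t / 2 * (b - a)\<^sup>2"
    by (auto simp: D_def numeral_2_eq_2)
  have "\<phi>'' t / 2 * (b - a)\<^sup>2 \<le> K / 2 * (b - a)\<^sup>2"
    using assms(4)[of t] t by (intro mult_right_mono) auto
  with eq show ?thesis by simp
qed

lemma second_order_lower_bound:
  fixes \<phi> \<phi>' \<phi>'' :: "real \<Rightarrow> real"
  assumes "a < b"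
    and "\<And>t. t \<in> {a..b} \<Longrightarrow> (\<phi> has_real_derivative \<phi>' t) (at t)"
    and "\<And>t. t \<in> {a..b} \<Longrightarrow> (\<phi>' has_real_derivative \<phi>'' t) (at t)"
    and "\<And>t. t \<in> {a..b} \<Longrightarrow> K \<le> \<phi>'' t"
  shows "\<phi> b + \<phi>' b * (a - b) + K / 2 * (a - b)\<^sup>2 \<le> \<phi> a"
proof -
  define D where "D m = (if m = 0 then \<phi> else if m = 1 then \<phi>' else \<phi>'')" for m :: nat
  have "\<exists>t::real. a < t \<and> t < b \<and>
    \<phi> a = (\<Sum>m<2. (D m b / fact m) * (a - b)^m) + (D 2 t / fact 2) * (a - b)^2"
    by (rule Taylor_down[where b = b]) (use assms in \<open>auto simp: D_def less_2_cases_iff\<close>)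
  then obtain t where t: "a < t" "t < b"
    and eq: "\<phi> a = \<phi> b + \<phi>' b * (a - b) + \<phi>'' t / 2 * (a - b)\<^sup>2"
    by (auto simp: D_def numeral_2_eq_2)
  have "K / 2 * (a - b)\<^sup>2 \<le> \<phi>'' t / 2 * (a - b)\<^sup>2"
    using assms(4)[of t] t by (intro mult_right_mono) auto
  with eq show ?thesis by simp
qed

text \<open>
  The upper curvature bound controls the drop on \<open>[0, t]\<close> from the left end, the lower one the drop on
  \<open>[t, 1]\<close> from the stationary point. At \<open>t = 1 / (1 + sqrt (hi / lo))\<close> the two quadratic terms
  cancel, and the linear term alone remains.
\<close>

lemma decrease_to_stationary_point:
  fixes \<phi> \<phi>' \<phi>'' :: "real \<Rightarrow> real"
  assumes d1: "\<And>t. t \<in> {0..1} \<Longrightarrow> (\<phi> has_real_derivative \<phi>' t) (at t)"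
    and d2: "\<And>t. t \<in> {0..1} \<Longrightarrow> (\<phi>' has_real_derivative \<phi>'' t) (at t)"
    and bounds: "\<And>t. t \<in> {0..1} \<Longrightarrow> lo \<le> \<phi>'' t" "\<And>t. t \<in> {0..1} \<Longrightarrow> \<phi>'' t \<le> hi"
    and lo: "lo > 0" and stationary: "\<phi>' 1 = 0"
  shows "\<phi> 0 - \<phi> 1 \<ge> - \<phi>' 0 / (1 + sqrt (hi / lo))"
proof -
  define q where "q = sqrt (hi / lo)"
  define t where "t = 1 / (1 + q)"
  have "hi \<ge> lo" using bounds[of 0] by simp
  then have q: "q > 0" "lo * q\<^sup>2 = hi" using lo by (auto simp: q_def)
  then have t: "0 < t" "t < 1" "1 - t = q * t" by (auto simp: t_def field_simps)
  have "\<phi> t \<le> \<phi> 0 + \<phi>' 0 * (t - 0) + hi / 2 * (t - 0)\<^sup>2"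
    by (rule second_order_upper_bound[of _ _ _ _ \<phi>'']) (use d1 d2 bounds t in auto)
  moreover have "\<phi> 1 + \<phi>' 1 * (t - 1) + lo / 2 * (t - 1)\<^sup>2 \<le> \<phi> t"
    by (rule second_order_lower_bound[of _ _ _ _ \<phi>'']) (use d1 d2 bounds t in auto)
  moreover have "lo * (t - 1)\<^sup>2 = hi * t\<^sup>2"
  proof -
    have "(t - 1)\<^sup>2 = (q * t)\<^sup>2"
      unfolding t(3)[symmetric] by (rule power2_commute)
    then show ?thesis using q(2) by (simp add: power_mult_distrib)
  qed
  ultimately have "\<phi> 0 - \<phi> 1 \<ge> - \<phi>' 0 * t"
    using stationary by simp
  then show ?thesis by (simp add: t_def q_def)
qed

text \<open>
  Used to pass from an inequality between values to one between derivatives at a point where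
  both sides agree.
\<close>

lemma right_derivative_nonneg:
  fixes \<psi> :: "real \<Rightarrow> real"
  assumes "(\<psi> has_real_derivative D) (at a)"
    and "e > 0" "\<And>t. 0 < t \<Longrightarrow> t < e \<Longrightarrow> \<psi> a \<le> \<psi> (a + t)"
  shows "D \<ge> 0"
proof (rule ccontr)
  assume "\<not> D \<ge> 0"
  then obtain d where d: "d > 0" "\<And>h. h > 0 \<Longrightarrow> h < d \<Longrightarrow> \<psi> (a + h) < \<psi> a"
    using DERIV_neg_dec_right[OF assms(1)] by (metis not_le)
  obtain h where "0 < h" "h < min d e"
    using d(1) assms(2) by (meson dense min_less_iff_conj)
  with d(2)[of h] assms(3)[of h] show False by auto
qed

section \<open>Smooth strongly convex functions\<close>

lemma spectral_norm_quadratic_form: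
  "\<bar>v \<bullet> (A *v v)\<bar> \<le> spectral_norm A * (norm v)\<^sup>2" for A :: "real^'n^'n"
proof -
  have "\<bar>v \<bullet> (A *v v)\<bar> \<le> norm v * norm (A *v v)" by (rule Cauchy_Schwarz_ineq2)
  also have "\<dots> \<le> norm v * (spectral_norm A * norm v)"
    unfolding spectral_norm_def by (intro mult_left_mono onorm) auto
  finally show ?thesis by (simp add: power2_eq_square mult_ac)
qed

locale smooth_strongly_convex =
  fixes f :: "real^'n \<Rightarrow> real" and \<mu> L :: real
  assumes C2: "twice_continuously_differentiable f"
    and mu_pos: "\<mu> > 0" and L_pos: "L > 0"
    and strong: "strongly_convex \<mu> f"
    and lipschitz: "\<forall>u v. norm (gradient f u - gradient f v) \<le> L * norm (u - v)"
begin

lemma has_derivative_f: "(f has_derivative (\<lambda>h. gradient f x \<bullet> h)) (at x)"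
proof -
  have "f differentiable (at x)"
    using C2 by (simp add: twice_continuously_differentiable_def)
  then obtain F where F: "(f has_derivative F) (at x)"
    by (auto simp: differentiable_def)
  then have "linear F" by (rule has_derivative_linear)
  define D where "D = adjoint F 1"
  have "F = (\<lambda>h. h \<bullet> D)"
    using adjoint_works[OF \<open>linear F\<close>, of _ 1] by (auto simp: D_def)
  then have "GDERIV f x :> D"
    using F by (simp add: gderiv_def)
  then have "GDERIV f x :> gradient f x"
    using gradient_eqI by metis
  then show ?thesis by (simp add: gderiv_def inner_commute)
qed

lemma has_derivative_gradient:
  "(gradient f has_derivative (\<lambda>h. hessian f x *v h)) (at x)"
  using C2 jacobian_works[of "gradient f" "at x"]
  by (simp add: twice_continuously_differentiable_def hessian_def)

lemma line_derivative:
  "((\<lambda>t. f (x + t *\<^sub>R s)) has_real_derivative (gradient f (x + t *\<^sub>R s) \<bullet> s)) (at t)"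
proof -
  have "((\<lambda>t. f (x + t *\<^sub>R s)) has_derivative (\<lambda>h. gradient f (x + t *\<^sub>R s) \<bullet> (h *\<^sub>R s))) (at t)"
    by (rule has_derivative_compose[OF _ has_derivative_f]) (auto intro!: derivative_eq_intros)
  then show ?thesis
    by (simp add: has_field_derivative_def mult_commute_abs)
qed

lemma line_second_derivative:
  "((\<lambda>t. gradient f (x + t *\<^sub>R s) \<bullet> s) has_real_derivative
     (s \<bullet> (hessian f (x + t *\<^sub>R s) *v s))) (at t)"
proof -
  have "((\<lambda>t. gradient f (x + t *\<^sub>R s)) has_derivative
      (\<lambda>h. hessian f (x + t *\<^sub>R s) *v (h *\<^sub>R s))) (at t)"
    by (rule has_derivative_compose[OF _ has_derivative_gradient]) (auto intro!: derivative_eq_intros)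
  then have "((\<lambda>t. gradient f (x + t *\<^sub>R s) \<bullet> s) has_derivative
      (\<lambda>h. (hessian f (x + t *\<^sub>R s) *v (h *\<^sub>R s)) \<bullet> s)) (at t)"
    by (rule has_derivative_inner_left)
  then show ?thesis
    by (simp add: has_field_derivative_def mult_commute_abs matrix_vector_mult_scaleR inner_commute)
qed

lemma strong_convexity_gradient:
  "f y \<ge> f x + gradient f x \<bullet> (y - x) + \<mu> / 2 * (norm (y - x))\<^sup>2"
proof -
  define n where "n = (norm (y - x))\<^sup>2"
  define \<psi> where "\<psi> t = (1 - t) * f x + t * f y - \<mu> / 2 * t * (1 - t) * n - f (x + t *\<^sub>R (y - x))" for t
  have "(\<psi> has_real_derivative (f y - f x - \<mu> / 2 * n - gradient f (x + 0 *\<^sub>R (y - x)) \<bullet> (y - x))) (at 0)"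
    unfolding \<psi>_def by (auto intro!: derivative_eq_intros line_derivative)
  moreover have "\<psi> 0 \<le> \<psi> (0 + t)" if "0 < t" "t < 1" for t
  proof -
    have "x + t *\<^sub>R (y - x) = (1 - t) *\<^sub>R x + t *\<^sub>R y"
      by (simp add: algebra_simps)
    with strong that show ?thesis
      by (auto simp: strongly_convex_def \<psi>_def n_def norm_minus_commute)
  qed
  ultimately have "f y - f x - \<mu> / 2 * n - gradient f (x + 0 *\<^sub>R (y - x)) \<bullet> (y - x) \<ge> 0"
    by (rule right_derivative_nonneg[OF _ zero_less_one])
  then show ?thesis by (simp add: n_def)
qed

text \<open>
  The second derivative along \<open>v\<close> is the rate of change of \<open>gradient f \<bullet> v\<close>. Adding the first-order strong
  convexity inequality at both ends of a segment bounds this rate from below, the Lipschitz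
  condition bounds it from above.
\<close>

lemma hessian_bounds:
  "\<mu> * (norm v)\<^sup>2 \<le> v \<bullet> (hessian f x *v v)"
  "v \<bullet> (hessian f x *v v) \<le> L * (norm v)\<^sup>2"
proof -
  define \<psi> where "\<psi> t = gradient f (x + t *\<^sub>R v) \<bullet> v" for t
  have d: "(\<psi> has_real_derivative (v \<bullet> (hessian f x *v v))) (at 0)"
    unfolding \<psi>_def using line_second_derivative[of x v 0] by simp
  have "((\<lambda>t. \<psi> t - t * (\<mu> * (norm v)\<^sup>2)) has_real_derivative
      (v \<bullet> (hessian f x *v v) - \<mu> * (norm v)\<^sup>2)) (at 0)"
    by (auto intro!: derivative_eq_intros d)
  moreover have "\<psi> 0 - 0 * (\<mu> * (norm v)\<^sup>2) \<le> \<psi> (0 + t) - (0 + t) * (\<mu> * (norm v)\<^sup>2)" if "0 < t" for t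
  proof -
    have "f (x + t *\<^sub>R v) \<ge> f x + t * \<psi> 0 + \<mu> / 2 * (t\<^sup>2 * (norm v)\<^sup>2)"
      using strong_convexity_gradient[of x "x + t *\<^sub>R v"] by (simp add: \<psi>_def power_mult_distrib)
    moreover have "f x \<ge> f (x + t *\<^sub>R v) - t * \<psi> t + \<mu> / 2 * (t\<^sup>2 * (norm v)\<^sup>2)"
      using strong_convexity_gradient[of "x + t *\<^sub>R v" x] by (simp add: \<psi>_def power_mult_distrib)
    moreover have "t * (t * (\<mu> * (norm v)\<^sup>2)) = \<mu> / 2 * (t\<^sup>2 * (norm v)\<^sup>2) + \<mu> / 2 * (t\<^sup>2 * (norm v)\<^sup>2)"
      by (simp add: power2_eq_square)
    ultimately have "t * (t * (\<mu> * (norm v)\<^sup>2)) \<le> t * (\<psi> t - \<psi> 0)"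
      unfolding right_diff_distrib by linarith
    then show ?thesis using that by simp
  qed
  ultimately have "v \<bullet> (hessian f x *v v) - \<mu> * (norm v)\<^sup>2 \<ge> 0"
    by (rule right_derivative_nonneg[OF _ zero_less_one])
  then show "\<mu> * (norm v)\<^sup>2 \<le> v \<bullet> (hessian f x *v v)" by simp
  have "((\<lambda>t. t * (L * (norm v)\<^sup>2) - \<psi> t) has_real_derivative
      (L * (norm v)\<^sup>2 - v \<bullet> (hessian f x *v v))) (at 0)"
    by (auto intro!: derivative_eq_intros d)
  moreover have "0 * (L * (norm v)\<^sup>2) - \<psi> 0 \<le> (0 + t) * (L * (norm v)\<^sup>2) - \<psi> (0 + t)" if "0 < t" for t
  proof -
    have "\<psi> t - \<psi> 0 = (gradient f (x + t *\<^sub>R v) - gradient f x) \<bullet> v"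
      by (simp add: \<psi>_def inner_diff_left)
    also have "\<dots> \<le> norm (gradient f (x + t *\<^sub>R v) - gradient f x) * norm v"
      by (rule norm_cauchy_schwarz)
    also have "\<dots> \<le> (L * norm (x + t *\<^sub>R v - x)) * norm v"
      using lipschitz by (intro mult_right_mono) (blast, simp)
    finally show ?thesis using that by (simp add: power2_eq_square mult_ac)
  qed
  ultimately have "L * (norm v)\<^sup>2 - v \<bullet> (hessian f x *v v) \<ge> 0"
    by (rule right_derivative_nonneg[OF _ zero_less_one])
  then show "v \<bullet> (hessian f x *v v) \<le> L * (norm v)\<^sup>2" by simp
qed

lemma mu_le_L: "\<mu> \<le> L"
proof -
  obtain v :: "real^'n" where "norm v = 1" using vector_choose_size[of 1] by auto
  with hessian_bounds[of v 0] show ?thesis by simp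
qed

lemma descent_inequality:
  "f y \<le> f x + gradient f x \<bullet> (y - x) + L / 2 * (norm (y - x))\<^sup>2"
proof -
  have "f (x + 1 *\<^sub>R (y - x)) \<le> f (x + 0 *\<^sub>R (y - x)) + (gradient f (x + 0 *\<^sub>R (y - x)) \<bullet> (y - x)) * (1 - 0)
      + (L * (norm (y - x))\<^sup>2) / 2 * (1 - 0)\<^sup>2"
    by (rule second_order_upper_bound[where \<phi> = "\<lambda>t. f (x + t *\<^sub>R (y - x))"])
       (auto intro: line_derivative line_second_derivative hessian_bounds)
  then show ?thesis by simp
qed

text \<open>
  The convex function \<open>\<lambda>z. f z - gradient f x \<bullet> z\<close> is minimal at \<open>x\<close>, yet a gradient step of
  length \<open>1 / L\<close> from \<open>y\<close> decreases it by the right-hand side.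
\<close>

lemma gradient_gap: "f y - f x - gradient f x \<bullet> (y - x) \<ge> (norm (gradient f y - gradient f x))\<^sup>2 / (2 * L)"
proof -
  define h where "h = gradient f y - gradient f x"
  define z where "z = y - (1 / L) *\<^sub>R h"
  have "f x + gradient f x \<bullet> (z - x) \<le> f z"
    using strong_convexity_gradient[of x z] mu_pos by (smt (verit) mult_nonneg_nonneg zero_le_power2 half_gt_zero)
  also have "f z \<le> f y + gradient f y \<bullet> (z - y) + L / 2 * (norm (z - y))\<^sup>2"
    by (rule descent_inequality)
  finally have 1: "f x + gradient f x \<bullet> (z - x) \<le> \<dots>" .
  have "gradient f y \<bullet> (z - y) - gradient f x \<bullet> (z - x) = h \<bullet> (z - y) - gradient f x \<bullet> (y - x)"
    by (simp add: h_def inner_diff_left inner_diff_right)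
  moreover have "h \<bullet> (z - y) = - ((norm h)\<^sup>2 / L)"
    by (simp add: z_def power2_norm_eq_inner)
  moreover have "L / 2 * (norm (z - y))\<^sup>2 = (norm h)\<^sup>2 / (2 * L)"
    using L_pos by (simp add: z_def power_mult_distrib power2_eq_square)
  moreover have "(norm h)\<^sup>2 / L = 2 * ((norm h)\<^sup>2 / (2 * L))" by simp
  ultimately have "f y - f x - gradient f x \<bullet> (y - x) \<ge> (norm h)\<^sup>2 / (2 * L)"
    using 1 by linarith
  then show ?thesis by (simp only: h_def)
qed

text \<open>
  The sum of the two inequalities of \<open>gradient_gap\<close> with \<open>x\<close> and \<open>y\<close> exchanged.
\<close>

lemma gradient_cocoercive:
  "(norm (gradient f y - gradient f x))\<^sup>2 \<le> L * ((y - x) \<bullet> (gradient f y - gradient f x))"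
proof -
  have "(norm (gradient f y - gradient f x))\<^sup>2 / (2 * L) * 2 \<le> (y - x) \<bullet> (gradient f y - gradient f x)"
    using gradient_gap[of x y] gradient_gap[of y x] 
    by (simp add: norm_minus_commute inner_diff_left inner_diff_right inner_commute)
  then show ?thesis using L_pos by (simp add: field_simps)
qed

text \<open>
  The Polyak-Lojasiewicz inequality: complete the square in the first-order strong convexity
  inequality.
\<close>

lemma gradient_dominance: "2 * \<mu> * (f x - f y) \<le> (norm (gradient f x))\<^sup>2"
proof -
  have "0 \<le> (norm (gradient f x + \<mu> *\<^sub>R (y - x)))\<^sup>2" by simp
  also have "\<dots> = (norm (gradient f x))\<^sup>2 + 2 * \<mu> * (gradient f x \<bullet> (y - x) + \<mu> / 2 * (norm (y - x))\<^sup>2)"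
    by (simp only: power2_norm_eq_inner inner_add_left inner_add_right)
       (simp add: power2_eq_square inner_commute algebra_simps)
  also have "\<dots> \<le> (norm (gradient f x))\<^sup>2 + 2 * \<mu> * (f y - f x)"
    using strong_convexity_gradient[of x y] mu_pos by (intro add_left_mono mult_left_mono) auto
  finally show ?thesis by (simp add: algebra_simps)
qed

lemma exact_step_decrease:
  assumes "gradient f (x + s) \<bullet> s = 0" "s \<noteq> 0"
  shows "f x - f (x + s) \<ge> - (gradient f x \<bullet> s) / (1 + sqrt (L / \<mu>))"
proof -
  have "f (x + 0 *\<^sub>R s) - f (x + 1 *\<^sub>R s) \<ge> - (gradient f (x + 0 *\<^sub>R s) \<bullet> s)
      / (1 + sqrt ((L * (norm s)\<^sup>2) / (\<mu> * (norm s)\<^sup>2)))"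
    by (rule decrease_to_stationary_point[where \<phi> = "\<lambda>t. f (x + t *\<^sub>R s)"])
       (use assms mu_pos in \<open>auto intro: line_derivative line_second_derivative hessian_bounds\<close>)
  then show ?thesis using assms by simp
qed

lemma segment_value_le:
  assumes "f (x + s) \<le> f x" "t \<in> {0..1}"
  shows "f (x + t *\<^sub>R s) \<le> f x"
proof -
  have "x + t *\<^sub>R s = (1 - t) *\<^sub>R x + t *\<^sub>R (x + s)"
    by (simp add: algebra_simps)
  then have "f (x + t *\<^sub>R s) \<le> (1 - t) * f x + t * f (x + s) - \<mu> / 2 * t * (1 - t) * (norm (x - (x + s)))\<^sup>2"
    using strong assms(2) by (simp only: strongly_convex_def)
  also have "\<dots> \<le> (1 - t) * f x + t * f x - 0"
    using assms mu_pos by (intro diff_mono add_left_mono mult_left_mono mult_nonneg_nonneg) auto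
  finally show ?thesis by (simp add: algebra_simps)
qed

end

section \<open>Hessians near the minimizer\<close>

locale smooth_strongly_convex_minimum = smooth_strongly_convex +
  fixes xs :: "real^'n" and M :: real
  assumes minimizer: "\<forall>z. f xs \<le> f z" and M_pos: "M > 0"
    and hess: "\<forall>z. spectral_norm (hessian f z - hessian f xs) \<le> M * norm (z - xs)"
begin

lemma gradient_minimizer: "gradient f xs = 0"
proof -
  have "f (xs - (1 / L) *\<^sub>R gradient f xs) \<le> f xs - (norm (gradient f xs))\<^sup>2 / (2 * L)"
    using descent_inequality[of "xs - (1 / L) *\<^sub>R gradient f xs" xs] L_pos
    by (simp add: power_mult_distrib power2_eq_square power2_norm_eq_inner[symmetric, unfolded power2_eq_square])
  moreover have "f xs \<le> f (xs - (1 / L) *\<^sub>R gradient f xs)" using minimizer by blast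
  ultimately have "(norm (gradient f xs))\<^sup>2 / (2 * L) \<le> 0" by linarith
  with L_pos have "(norm (gradient f xs))\<^sup>2 \<le> 0" by (simp add: divide_le_0_iff)
  then show ?thesis by simp
qed

lemma quadratic_growth: "\<mu> / 2 * (norm (x - xs))\<^sup>2 \<le> f x - f xs"
  using strong_convexity_gradient[of xs x] gradient_minimizer by simp

lemma value_gap_pos: "x \<noteq> xs \<Longrightarrow> f x - f xs > 0"
  using quadratic_growth[of x] mu_pos
  by (smt (verit) half_gt_zero mult_pos_pos right_minus_eq zero_less_norm_iff zero_less_power)

text \<open>
  On the sublevel set of \<open>x\<close>, the distance to the minimizer is at most
  \<open>sqrt (2 * (f x - f xs) / \<mu>)\<close>. Multiplied by \<open>M\<close> this bounds the deviation of the Hessian there from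
  that at the minimizer, and division by \<open>\<mu>\<close> makes it relative.
\<close>

definition hessian_spread :: "real^'n \<Rightarrow> real" where
  "hessian_spread x = M / \<mu> * sqrt (2 * (f x - f xs) / \<mu>)"

lemma hessian_spread_bounds:
  assumes "f z \<le> f x"
  defines "c \<equiv> hessian_spread x"
  shows "v \<bullet> (hessian f z *v v) \<le> (1 + c) * (v \<bullet> (hessian f xs *v v))"
    and "v \<bullet> (hessian f xs *v v) \<le> (1 + c) * (v \<bullet> (hessian f z *v v))"
    and "c \<ge> 0"
proof -
  have "(norm (z - xs))\<^sup>2 \<le> 2 * (f x - f xs) / \<mu>"
    using quadratic_growth[of z] assms(1) mu_pos by (simp add: field_simps)
  then have r: "norm (z - xs) \<le> sqrt (2 * (f x - f xs) / \<mu>)"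
    by (rule real_le_rsqrt)
  then show c: "c \<ge> 0"
    unfolding c_def hessian_spread_def using M_pos mu_pos order_trans[OF norm_ge_zero r]
    by (intro mult_nonneg_nonneg) auto
  have "\<bar>v \<bullet> (hessian f z *v v) - v \<bullet> (hessian f xs *v v)\<bar>
      = \<bar>v \<bullet> ((hessian f z - hessian f xs) *v v)\<bar>"
    by (simp add: matrix_vector_mult_diff_rdistrib inner_diff_right)
  also have "\<dots> \<le> spectral_norm (hessian f z - hessian f xs) * (norm v)\<^sup>2"
    by (rule spectral_norm_quadratic_form)
  also have "\<dots> \<le> (M * sqrt (2 * (f x - f xs) / \<mu>)) * (norm v)\<^sup>2"
    using hess r M_pos by (intro mult_right_mono) (auto intro: order_trans)
  also have "\<dots> = c * (\<mu> * (norm v)\<^sup>2)"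
    using mu_pos by (simp add: c_def hessian_spread_def)
  finally have *: "\<bar>v \<bullet> (hessian f z *v v) - v \<bullet> (hessian f xs *v v)\<bar> \<le> c * (\<mu> * (norm v)\<^sup>2)" .
  have "c * (\<mu> * (norm v)\<^sup>2) \<le> c * (v \<bullet> (hessian f w *v v))" for w
    using c hessian_bounds(1) by (intro mult_left_mono)
  from this[of z] this[of xs] *
  show "v \<bullet> (hessian f z *v v) \<le> (1 + c) * (v \<bullet> (hessian f xs *v v))"
    and "v \<bullet> (hessian f xs *v v) \<le> (1 + c) * (v \<bullet> (hessian f z *v v))"
    by (auto simp: algebra_simps)
qed

text \<open>
  With \<open>c\<close> the Hessian spread at \<open>x\<close>, the second derivative along the step varies between
  \<open>h / (1 + c)\<close> and \<open>h * (1 + c)\<close>, where \<open>h\<close> comes from the Hessian at the minimizer. The ratio of these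
  bounds is the square of \<open>1 + c\<close>, whose root is exact.
\<close>

lemma exact_step_decrease_local:
  assumes "gradient f (x + s) \<bullet> s = 0" "s \<noteq> 0" "f (x + s) \<le> f x"
  shows "f x - f (x + s) \<ge> - (gradient f x \<bullet> s) / (2 + hessian_spread x)"
proof -
  define c where "c = hessian_spread x"
  define h where "h = s \<bullet> (hessian f xs *v s)"
  have c: "c \<ge> 0" using hessian_spread_bounds(3)[of x x] by (simp add: c_def)
  have "0 < \<mu> * (norm s)\<^sup>2" using mu_pos assms(2) by simp
  then have h: "h > 0" using hessian_bounds(1)[of s xs] by (simp add: h_def)
  have lower: "h / (1 + c) \<le> s \<bullet> (hessian f (x + t *\<^sub>R s) *v s)"
    and upper: "s \<bullet> (hessian f (x + t *\<^sub>R s) *v s) \<le> h * (1 + c)" if "t \<in> {0..1}" for t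
    using hessian_spread_bounds(1,2)[OF segment_value_le[OF assms(3) that], of s] c
    by (auto simp: h_def c_def divide_le_eq mult_ac)
  have "f (x + 0 *\<^sub>R s) - f (x + 1 *\<^sub>R s) \<ge> - (gradient f (x + 0 *\<^sub>R s) \<bullet> s)
      / (1 + sqrt ((h * (1 + c)) / (h / (1 + c))))"
    by (rule decrease_to_stationary_point[where \<phi> = "\<lambda>t. f (x + t *\<^sub>R s)"])
       (use assms h c lower upper in \<open>auto intro: line_derivative line_second_derivative\<close>)
  moreover have "(h * (1 + c)) / (h / (1 + c)) = (1 + c)\<^sup>2"
    using h c by (simp add: power2_eq_square)
  ultimately show ?thesis using c by (simp add: c_def)
qed

end

section \<open>Products, sums and exponentials\<close>

lemma prod_le_mean_power:
  fixes z :: "nat \<Rightarrow> real"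
  assumes "k \<ge> 1" "\<And>i. i < k \<Longrightarrow> z i \<ge> 0"
  shows "(\<Prod>i<k. z i) \<le> ((\<Sum>i<k. z i) / k) ^ k"
proof -
  have P: "(\<Prod>i<k. z i) \<ge> 0" using assms(2) by (intro prod_nonneg) auto
  have "(\<Prod>i<k. z i) powr (1 / card {..<k}) \<le> (\<Sum>i<k. z i / card {..<k})"
    by (rule arith_geom_mean) (use assms in \<open>auto simp: lessThan_empty_iff\<close>)
  then have "(\<Prod>i<k. z i) powr (1 / k) \<le> (\<Sum>i<k. z i) / k"
    by (simp add: sum_divide_distrib)
  then have "((\<Prod>i<k. z i) powr (1 / k)) ^ k \<le> ((\<Sum>i<k. z i) / k) ^ k"
    by (intro power_mono) auto
  moreover have "((\<Prod>i<k. z i) powr (1 / k)) ^ k = (\<Prod>i<k. z i)"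
    using assms(1) P
    by (cases "(\<Prod>i<k. z i) = 0")
       (auto simp: powr_realpow[symmetric] powr_powr power_0_left simp del: prod_zero_iff)
  ultimately show ?thesis by simp
qed

text \<open>
  Both uses of the inequality of arithmetic and geometric means: the geometric mean of the
  \<open>1 - z i\<close> is at most \<open>1 - m\<close> with \<open>m\<close> the arithmetic mean of the \<open>z i\<close>, and \<open>m\<close> is at least their
  geometric mean, hence at least \<open>c\<close>.
\<close>

lemma prod_one_minus_le:
  fixes z :: "nat \<Rightarrow> real"
  assumes "k \<ge> 1" and z: "\<And>i. i < k \<Longrightarrow> 0 \<le> z i" "\<And>i. i < k \<Longrightarrow> z i \<le> 1"
    and c: "c \<ge> 0" "c ^ k \<le> (\<Prod>i<k. z i)"
  shows "(\<Prod>i<k. 1 - z i) \<le> (1 - c) ^ k"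
proof -
  define m where "m = (\<Sum>i<k. z i) / k"
  have m: "0 \<le> m" unfolding m_def using z(1) by (intro divide_nonneg_nonneg sum_nonneg) auto
  have "c ^ k \<le> m ^ k"
    using c(2) prod_le_mean_power[OF assms(1), of z] z(1) by (auto simp: m_def)
  then have "c \<le> m"
    using m assms(1) c(1) by (simp add: power_mono_iff)
  have "(\<Sum>i<k. z i) \<le> k"
    using sum_bounded_above[of "{..<k}" z 1] z(2) by simp
  then have m1: "m \<le> 1" using assms(1) by (simp add: m_def)
  have "(\<Prod>i<k. 1 - z i) \<le> ((\<Sum>i<k. 1 - z i) / k) ^ k"
    using z(2) by (intro prod_le_mean_power assms(1)) auto
  also have "(\<Sum>i<k. 1 - z i) / k = 1 - m"
    using assms(1) by (simp add: m_def sum_subtractf diff_divide_distrib)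
  also have "(1 - m) ^ k \<le> (1 - c) ^ k"
    using \<open>c \<le> m\<close> m1 by (intro power_mono) auto
  finally show ?thesis .
qed

lemma exp_minus_ge_third_power:
  assumes "a \<le> real k"
  shows "(1 / 3) ^ k \<le> exp (- a)"
proof -
  have "exp (real k) = exp 1 ^ k" by (simp flip: exp_of_nat_mult)
  also have "\<dots> \<le> 3 ^ k" by (intro power_mono exp_le) simp
  finally have "exp a \<le> 3 ^ k" using assms by (meson exp_le_cancel_iff order_trans)
  then have "inverse (3 ^ k) \<le> inverse (exp a)" by (rule le_imp_inverse_le) simp
  then show ?thesis
    by (simp add: power_one_over exp_minus inverse_eq_divide)
qed

text \<open>
  Before the decay sets in there are at most \<open>K\<close> positive indices, each contributing at most \<open>D\<close>. The
  index \<open>0\<close> is the first term of the geometric series, which absorbs the rounding of \<open>K\<close>.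
\<close>

lemma sum_le_with_late_geometric_decay:
  fixes C :: "nat \<Rightarrow> real"
  assumes r: "0 \<le> r" "r < 1" and K: "K \<ge> 0" and D: "D \<ge> 0"
    and bounded: "\<And>i. C i \<le> D"
    and decay: "\<And>i. i \<ge> 1 \<Longrightarrow> real i \<ge> K \<Longrightarrow> C i \<le> D * r ^ i"
  shows "(\<Sum>i<k. C i) \<le> D * (K + 1 / (1 - r))"
proof -
  define early where "early = {i. 1 \<le> i \<and> real i < K}"
  have sub: "early \<subseteq> {1..nat \<lfloor>K\<rfloor>}"
    unfolding early_def using K by (auto simp: le_nat_floor less_imp_le)
  have "C i \<le> D * (indicator early i + r ^ i)" for i
  proof (cases "i = 0 \<or> i \<in> early")
    case True
    have "D * 1 \<le> D * (indicator early i + r ^ i)"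
      using True D r(1) by (intro mult_left_mono) auto
    with bounded[of i] show ?thesis by simp
  next
    case False
    then show ?thesis using decay[of i] by (simp add: early_def not_less)
  qed
  then have "(\<Sum>i<k. C i) \<le> (\<Sum>i<k. D * (indicator early i + r ^ i))"
    by (rule sum_mono)
  also have "\<dots> = D * ((\<Sum>i<k. indicator early i) + (\<Sum>i<k. r ^ i))"
    by (simp add: sum_distrib_left sum.distrib distrib_left)
  also have "\<dots> \<le> D * (K + 1 / (1 - r))"
  proof (intro mult_left_mono add_mono D)
    have "(\<Sum>i<k. indicator early i) = real (card ({..<k} \<inter> early))"
      by (simp add: indicator_def sum.If_cases Int_def)
    also have "\<dots> \<le> real (card {1..nat \<lfloor>K\<rfloor>})"
      using sub by (intro of_nat_mono card_mono) auto
    also have "\<dots> \<le> K" using K by simp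
    finally show "(\<Sum>i<k. indicator early i) \<le> K" .
    have "(\<Sum>i<k. r ^ i) = (1 - r ^ k) / (1 - r)"
      using r by (simp add: sum_gp_strict)
    also have "\<dots> \<le> 1 / (1 - r)" using r by (intro divide_right_mono) auto
    finally show "(\<Sum>i<k. r ^ i) \<le> 1 / (1 - r)" .
  qed
  finally show ?thesis .
qed

section \<open>The iteration\<close>

locale bfgs_iteration = smooth_strongly_convex_minimum f \<mu> L xs M
  for f :: "real^'n \<Rightarrow> real" and \<mu> L M and xs :: "real^'n" +
  fixes x :: "nat \<Rightarrow> real^'n" and B :: "nat \<Rightarrow> real^'n^'n"
  assumes B0: "sym_pos_def (B 0)"
    and bfgs: "bfgs_exact_line_search f x B"
    and nonopt: "\<forall>k. x k \<noteq> xs"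
begin

definition step :: "nat \<Rightarrow> real^'n" where "step k = x (Suc k) - x k"

text \<open>
  The decrement is the decrease of \<open>f\<close> along the step that the gradient predicts.
\<close>

definition decrement :: "nat \<Rightarrow> real" where "decrement k = - (gradient f (x k) \<bullet> step k)"

definition gap :: "nat \<Rightarrow> real" where "gap k = f (x k) - f xs"

lemma gap_pos: "gap k > 0"
  using nonopt value_gap_pos by (simp add: gap_def)

lemma gradient_nonzero: "gradient f (x k) \<noteq> 0"
  using gradient_dominance[of "x k" xs] gap_pos[of k] mu_pos
  by (auto simp: gap_def mult_le_0_iff)

lemma B_Suc: "B (Suc k) = bfgs_update (B k) (step k) (gradient f (x (Suc k)) - gradient f (x k))"
  using bfgs by (simp add: bfgs_exact_line_search_def Let_def step_def)

text \<open>
  The search direction is a descent direction because \<open>B k\<close> is positive definite. So the line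
  search stops at a positive step length, an interior minimum, where the new gradient is orthogonal
  to the step.
\<close>

lemma exact_line_search_step:
  assumes B: "sym_pos_def (B k)"
  obtains \<eta> where "\<eta> > 0" "B k *v step k = - \<eta> *\<^sub>R gradient f (x k)"
    "gradient f (x (Suc k)) \<bullet> step k = 0" "decrement k > 0" "f (x (Suc k)) \<le> f (x k)"
proof -
  define g where "g = gradient f (x k)"
  define d where "d = - (matrix_inv (B k) *v g)"
  define \<phi> where "\<phi> \<eta> = f (x k + \<eta> *\<^sub>R d)" for \<eta>
  obtain \<eta> where am: "is_arg_min \<phi> (\<lambda>\<eta>. \<eta> \<ge> 0) \<eta>" and xS: "x (Suc k) = x k + \<eta> *\<^sub>R d"
    using bfgs unfolding bfgs_exact_line_search_def Let_def \<phi>_def d_def g_def by metis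
  have min: "\<phi> \<eta> \<le> \<phi> t" if "t \<ge> 0" for t
    using am that by (auto simp: is_arg_min_linorder)
  have eta0: "\<eta> \<ge> 0" using am by (simp add: is_arg_min_def)
  have Bd: "B k *v d = - g"
    using sym_pos_def_mult_inverse[OF B, of g] by (simp add: d_def linear_neg)
  have g: "g \<noteq> 0" using gradient_nonzero by (simp add: g_def)
  then have "d \<noteq> 0" using Bd by auto
  then have gd: "g \<bullet> d < 0"
    using sym_pos_def_pos[OF B, of d] by (simp add: Bd inner_commute)
  have deriv: "(\<phi> has_real_derivative (gradient f (x k + t *\<^sub>R d) \<bullet> d)) (at t)" for t
    unfolding \<phi>_def by (rule line_derivative)
  have "\<eta> \<noteq> 0"
  proof
    assume "\<eta> = 0"
    then have "\<And>t. 0 < t \<Longrightarrow> \<phi> 0 \<le> \<phi> (0 + t)" using min by simp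
    with right_derivative_nonneg[OF deriv[of 0] zero_less_one] have "g \<bullet> d \<ge> 0"
      by (simp add: g_def)
    with gd show False by simp
  qed
  with eta0 have eta: "\<eta> > 0" by simp
  have "gradient f (x k + \<eta> *\<^sub>R d) \<bullet> d = 0"
    by (rule DERIV_local_min[OF deriv eta]) (use min eta in auto)
  moreover have sk: "step k = \<eta> *\<^sub>R d" by (simp add: step_def xS)
  ultimately have "gradient f (x (Suc k)) \<bullet> step k = 0" by (simp add: xS)
  moreover have "decrement k > 0" using gd eta by (simp add: decrement_def sk g_def[symmetric] mult_pos_neg)
  moreover have "B k *v step k = - \<eta> *\<^sub>R g" by (simp add: sk matrix_vector_mult_scaleR Bd)
  moreover have "f (x (Suc k)) \<le> f (x k)" using min[of 0] by (simp add: \<phi>_def xS)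
  ultimately show ?thesis using that[OF eta] by (simp add: g_def)
qed

text \<open>
  Exact line search turns the curvature \<open>s \<bullet> y\<close>, which the update needs to be positive, into the
  decrement.
\<close>

lemma curvature:
  assumes "sym_pos_def (B k)"
  shows "step k \<bullet> (gradient f (x (Suc k)) - gradient f (x k)) = decrement k"
  using exact_line_search_step[OF assms]
  by (metis decrement_def inner_diff_right inner_commute diff_0)

lemma sym_pos_def_B: "sym_pos_def (B k)"
proof (induction k)
  case 0
  show ?case by (rule B0)
next
  case (Suc k)
  then have "decrement k > 0" by (rule exact_line_search_step)
  with Suc show ?case
    by (simp add: B_Suc sym_pos_def_bfgs_update curvature)
qed

lemma decrement_pos: "decrement k > 0"
  by (rule exact_line_search_step[OF sym_pos_def_B])

lemma gap_antimono: "i \<le> j \<Longrightarrow> gap j \<le> gap i"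
proof (rule lift_Suc_antimono_le)
  show "gap (Suc k) \<le> gap k" for k
    using exact_line_search_step[OF sym_pos_def_B, of k] by (metis gap_def diff_right_mono)
qed

text \<open>
  Up to the factor \<open>L\<close> this is the squared cosine of the angle between step and negative gradient,
  divided by the mean curvature along the step. A factor \<open>|step|\<^sup>2\<close> cancels, and so does one factor
  \<open>decrement k\<close>, by \<open>curvature\<close>.
\<close>

definition alignment :: "nat \<Rightarrow> real" where "alignment k = L * decrement k / (norm (gradient f (x k)))\<^sup>2"

lemma alignment_pos: "alignment k > 0"
  using decrement_pos L_pos gradient_nonzero by (simp add: alignment_def)

text \<open>
  The term \<open>|y|\<^sup>2 / (s \<bullet> y) - 1\<close> of \<open>Psi_bfgs_update_le\<close>, with \<open>y\<close> divided by \<open>L\<close>, is at most zero by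
  cocoercivity. In the logarithm, \<open>B s\<close> is a multiple of the gradient, and the step length cancels.
\<close>

lemma Psi_step: "Psi ((1 / L) *\<^sub>R B (Suc k)) \<le> Psi ((1 / L) *\<^sub>R B k) + ln (alignment k)"
proof -
  define y where "y = gradient f (x (Suc k)) - gradient f (x k)"
  define g where "g = gradient f (x k)"
  obtain \<eta> where eta: "\<eta> > 0" "B k *v step k = - \<eta> *\<^sub>R g"
    using exact_line_search_step[OF sym_pos_def_B, of k] unfolding g_def by metis
  have sy: "step k \<bullet> y = decrement k" unfolding y_def by (rule curvature[OF sym_pos_def_B])
  have sym: "sym_pos_def ((1 / L) *\<^sub>R B k)"
    using L_pos by (intro sym_pos_def_scaleR sym_pos_def_B) simp
  have sy': "step k \<bullet> ((1 / L) *\<^sub>R y) > 0" using sy decrement_pos L_pos by simp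
  have "(1 / L) *\<^sub>R B (Suc k) = bfgs_update ((1 / L) *\<^sub>R B k) (step k) ((1 / L) *\<^sub>R y)"
    using L_pos by (simp add: B_Suc y_def bfgs_update_scaleR sym_pos_def_B)
  moreover have "(norm ((1 / L) *\<^sub>R y))\<^sup>2 / (step k \<bullet> ((1 / L) *\<^sub>R y)) - 1 \<le> 0"
  proof -
    have "(norm y)\<^sup>2 \<le> L * decrement k"
      using gradient_cocoercive[of "x (Suc k)" "x k"] sy by (simp add: y_def step_def)
    then show ?thesis
      using sy L_pos decrement_pos[of k] by (simp add: power_divide power2_eq_square field_simps)
  qed
  moreover have "(step k \<bullet> (((1 / L) *\<^sub>R B k) *v step k))\<^sup>2
      / ((norm (((1 / L) *\<^sub>R B k) *v step k))\<^sup>2 * (step k \<bullet> ((1 / L) *\<^sub>R y))) = alignment k"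
  proof -
    have v: "((1 / L) *\<^sub>R B k) *v step k = (- \<eta> / L) *\<^sub>R g"
      by (simp add: scaleR_matrix_vector_assoc[symmetric] eta(2))
    have "step k \<bullet> g = - decrement k" by (simp add: decrement_def g_def inner_commute)
    then show ?thesis
      unfolding v using eta(1) L_pos decrement_pos[of k] gradient_nonzero[of k] sy
      by (simp add: alignment_def g_def power_mult_distrib power_divide field_simps power2_eq_square)
  qed
  ultimately show ?thesis
    using Psi_bfgs_update_le[OF sym sy'] by simp
qed

text \<open>
  The steps of \<open>Psi_step\<close> telescope, and \<open>Psi\<close> stays nonnegative.
\<close>

lemma prod_alignment_ge: "(\<Prod>i<k. alignment i) \<ge> exp (- Psi ((1 / L) *\<^sub>R B 0))"
proof -
  have pos: "(\<Prod>i<j. alignment i) > 0" for j by (intro prod_pos alignment_pos)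
  have "Psi ((1 / L) *\<^sub>R B j) \<le> Psi ((1 / L) *\<^sub>R B 0) + ln (\<Prod>i<j. alignment i)" for j
  proof (induction j)
    case (Suc j)
    with Psi_step[of j] show ?case by (simp add: ln_mult_pos pos alignment_pos)
  qed simp
  moreover have "Psi ((1 / L) *\<^sub>R B k) \<ge> 0"
    using L_pos by (intro Psi_nonneg sym_pos_def_scaleR sym_pos_def_B) simp
  ultimately have "- Psi ((1 / L) *\<^sub>R B 0) \<le> ln (\<Prod>i<k. alignment i)" by smt
  then show ?thesis using pos by (simp add: ln_ge_iff)
qed

definition \<kappa> :: real where "\<kappa> = L / \<mu>"

text \<open>
  \<open>C k\<close> is the constant \<open>C\<^sub>0\<close> of the theorem with the \<open>k\<close>-th iterate as starting point.
\<close>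

definition C :: "nat \<Rightarrow> real" where "C k = 2 * hessian_spread (x k)"

definition gain :: "nat \<Rightarrow> real" where
  "gain k = 1 / \<kappa> * max (2 / (1 + sqrt \<kappa>)) (1 / (1 + C k))"

lemma kappa_ge_1: "\<kappa> \<ge> 1" using mu_le_L mu_pos by (simp add: \<kappa>_def)

lemma C_nonneg: "C k \<ge> 0"
  using hessian_spread_bounds(3)[of "x k" "x k"] by (simp add: C_def)

lemma gain_pos: "gain k > 0"
proof -
  have "2 / (1 + sqrt \<kappa>) > 0" using kappa_ge_1 by (simp add: add_pos_nonneg)
  then show ?thesis using kappa_ge_1 by (simp add: gain_def less_max_iff_disj)
qed

lemma gain_le_1: "gain k \<le> 1"
proof -
  have "1 \<le> sqrt \<kappa>" using kappa_ge_1 by simp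
  then have "2 / (1 + sqrt \<kappa>) \<le> 1" by (simp add: divide_le_eq del: real_sqrt_ge_1_iff)
  moreover have "1 / (1 + C k) \<le> 1" using C_nonneg[of k] by simp
  ultimately have "gain k \<le> 1 / \<kappa> * 1"
    unfolding gain_def using kappa_ge_1 by (intro mult_left_mono) auto
  also have "\<dots> \<le> 1" using kappa_ge_1 by simp
  finally show ?thesis .
qed

lemma gain_ge_initial: "gain 0 \<le> gain k"
proof -
  have "C k \<le> C 0"
    unfolding C_def hessian_spread_def using gap_antimono[of 0 k] mu_pos M_pos
    by (intro mult_left_mono real_sqrt_le_mono divide_right_mono) (auto simp: gap_def)
  then have "1 / (1 + C 0) \<le> 1 / (1 + C k)"
    using C_nonneg by (intro divide_left_mono) (auto intro!: mult_pos_pos add_pos_nonneg)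
  then show ?thesis
    unfolding gain_def using kappa_ge_1 by (intro mult_left_mono max.mono) auto
qed

text \<open>
  The gain collects the global and the local estimate of the decrease. The local one would allow
  \<open>2 + C k / 2\<close> instead of \<open>2 * (1 + C k)\<close>.
\<close>

lemma decrease_ge: "gap k - gap (Suc k) \<ge> \<kappa> / 2 * gain k * decrement k"
proof -
  have s0: "step k \<noteq> 0" using decrement_pos[of k] by (auto simp: decrement_def)
  have xS: "x (Suc k) = x k + step k" by (simp add: step_def)
  have orth: "gradient f (x k + step k) \<bullet> step k = 0" and le: "f (x k + step k) \<le> f (x k)"
    using exact_line_search_step[OF sym_pos_def_B, of k] unfolding xS by blast+
  have D: "gap k - gap (Suc k) = f (x k) - f (x k + step k)" by (simp add: gap_def xS)
  have "gap k - gap (Suc k) \<ge> decrement k / (1 + sqrt \<kappa>)"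
    using exact_step_decrease[OF orth s0] by (simp only: D decrement_def \<kappa>_def)
  moreover have "gap k - gap (Suc k) \<ge> decrement k / (2 * (1 + C k))"
  proof -
    have "decrement k / (2 * (1 + C k)) \<le> decrement k / (2 + hessian_spread (x k))"
      using decrement_pos[of k] C_nonneg[of k] by (intro divide_left_mono mult_pos_pos) (auto simp: C_def)
    with exact_step_decrease_local[OF orth s0 le] show ?thesis by (simp only: D decrement_def)
  qed
  moreover have "\<kappa> / 2 * gain k * decrement k = max (decrement k / (1 + sqrt \<kappa>)) (decrement k / (2 * (1 + C k)))"
  proof -
    have "\<kappa> / 2 * gain k * decrement k = (decrement k / 2) * max (2 / (1 + sqrt \<kappa>)) (1 / (1 + C k))"
      using kappa_ge_1 by (simp add: gain_def)
    also have "\<dots> = max ((decrement k / 2) * (2 / (1 + sqrt \<kappa>))) ((decrement k / 2) * (1 / (1 + C k)))"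
      using decrement_pos[of k] by (intro max_mult_distrib_left[THEN trans]) simp
    finally show ?thesis by simp
  qed
  ultimately show ?thesis by simp
qed

lemma contraction: "gap (Suc k) \<le> (1 - gain k * alignment k) * gap k"
proof -
  have "alignment k * (2 * \<mu> * gap k) \<le> alignment k * (norm (gradient f (x k)))\<^sup>2"
    using gradient_dominance[of "x k" xs] alignment_pos[of k] by (intro mult_left_mono) (auto simp: gap_def)
  also have "\<dots> = L * decrement k" using gradient_nonzero by (simp add: alignment_def)
  finally have "alignment k * gap k \<le> \<kappa> / 2 * decrement k"
    using mu_pos by (simp add: \<kappa>_def field_simps)
  then have "gain k * (alignment k * gap k) \<le> gain k * (\<kappa> / 2 * decrement k)"
    using gain_pos[of k] by (intro mult_left_mono) auto
  with decrease_ge[of k] have "gain k * (alignment k * gap k) \<le> gap k - gap (Suc k)"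
    by (simp add: mult_ac)
  then show ?thesis by (simp add: left_diff_distrib mult.assoc)
qed

text \<open>
  The form in which the three rates are derived: only a lower bound for the product of the gains is
  left to be found.
\<close>

lemma rate:
  assumes k: "k \<ge> 1" and c: "c \<ge> 0"
    and le: "c ^ k \<le> exp (- Psi ((1 / L) *\<^sub>R B 0)) * (\<Prod>i<k. gain i)"
  shows "gap k / gap 0 \<le> (1 - c) ^ k"
proof -
  have z0: "0 \<le> gain i * alignment i" for i using gain_pos alignment_pos by (simp add: less_imp_le)
  have z1: "gain i * alignment i \<le> 1" for i
  proof -
    have "0 < (1 - gain i * alignment i) * gap i" using contraction[of i] gap_pos[of "Suc i"] by simp
    then show ?thesis using gap_pos[of i] by (simp add: zero_less_mult_iff)
  qed
  have "gap j \<le> (\<Prod>i<j. 1 - gain i * alignment i) * gap 0" for j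
  proof (induction j)
    case (Suc j)
    have "gap (Suc j) \<le> (1 - gain j * alignment j) * gap j" by (rule contraction)
    also have "\<dots> \<le> (1 - gain j * alignment j) * ((\<Prod>i<j. 1 - gain i * alignment i) * gap 0)"
      using Suc z1[of j] by (intro mult_left_mono) auto
    finally show ?case by (simp add: mult_ac)
  qed simp
  then have "gap k / gap 0 \<le> (\<Prod>i<k. 1 - gain i * alignment i)"
    using gap_pos[of 0] by (simp add: divide_le_eq)
  also have "\<dots> \<le> (1 - c) ^ k"
  proof (rule prod_one_minus_le[OF k z0 z1 c])
    have "c ^ k \<le> (\<Prod>i<k. alignment i) * (\<Prod>i<k. gain i)"
      using prod_alignment_ge[of k] gain_pos
      by (intro order_trans[OF le] mult_right_mono prod_nonneg) (auto simp: less_imp_le)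
    then show "c ^ k \<le> (\<Prod>i<k. gain i * alignment i)" by (simp add: prod.distrib mult.commute)
  qed
  finally show ?thesis .
qed

lemma prod_gain_ge: "gain 0 ^ k \<le> (\<Prod>i<k. gain i)"
proof -
  have "(\<Prod>i<k. gain 0) \<le> (\<Prod>i<k. gain i)"
    using gain_ge_initial gain_pos by (intro prod_mono) (auto simp: less_imp_le)
  then show ?thesis by simp
qed

lemma linear_rate:
  assumes "k \<ge> 1"
  shows "gap k / gap 0 \<le> (1 - exp (- (Psi ((1 / L) *\<^sub>R B 0) / real k)) * gain 0) ^ k"
proof (rule rate[OF assms])
  show "0 \<le> exp (- (Psi ((1 / L) *\<^sub>R B 0) / real k)) * gain 0" using gain_pos[of 0] by simp
  have "exp (- (Psi ((1 / L) *\<^sub>R B 0) / real k)) ^ k = exp (- Psi ((1 / L) *\<^sub>R B 0))"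
    using assms by (simp flip: exp_of_nat_mult)
  then show "(exp (- (Psi ((1 / L) *\<^sub>R B 0) / real k)) * gain 0) ^ k
      \<le> exp (- Psi ((1 / L) *\<^sub>R B 0)) * (\<Prod>i<k. gain i)"
    using prod_gain_ge[of k] by (simp add: power_mult_distrib)
qed

text \<open>
  For such \<open>k\<close> the factor lost to \<open>Psi\<close> is at most \<open>e\<close> per step, and \<open>e \<le> 3\<close>.
\<close>

lemma linear_rate_after_Psi:
  assumes "k \<ge> 1" "real k \<ge> Psi ((1 / L) *\<^sub>R B 0)"
  shows "gap k / gap 0 \<le> (1 - gain 0 / 3) ^ k"
proof (rule rate[OF assms(1)])
  show "0 \<le> gain 0 / 3" using gain_pos[of 0] by simp
  have "(1 / 3) ^ k * gain 0 ^ k \<le> exp (- Psi ((1 / L) *\<^sub>R B 0)) * (\<Prod>i<k. gain i)"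
    using exp_minus_ge_third_power[OF assms(2)] prod_gain_ge[of k] gain_pos[of 0]
    by (intro mult_mono) (auto simp: less_imp_le)
  then show "(gain 0 / 3) ^ k \<le> exp (- Psi ((1 / L) *\<^sub>R B 0)) * (\<Prod>i<k. gain i)"
    by (simp add: power_divide)
qed

text \<open>
  \<open>C i\<close> is proportional to the square root of the optimality gap, so it is at most \<open>C 0\<close> always, and
  from step \<open>Psi B0bar\<close> on it decays like \<open>r ^ i\<close>, with \<open>r\<close> the square root of the rate just proved.
\<close>

lemma sum_C_le:
  "(\<Sum>i<k. C i) \<le> C 0 * (Psi ((1 / L) *\<^sub>R B 0) + 3 * \<kappa> * min (2 * (1 + C 0)) (1 + sqrt \<kappa>))"
proof -
  define \<rho> where "\<rho> = gain 0 / 3"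
  define r where "r = sqrt (1 - \<rho>)"
  have rho: "0 < \<rho>" "\<rho> \<le> 1" using gain_pos[of 0] gain_le_1[of 0] by (auto simp: \<rho>_def)
  then have r: "0 \<le> r" "r < 1" "r\<^sup>2 = 1 - \<rho>"
    by (auto simp: r_def)
  have C_gap: "C i = C 0 * sqrt (gap i / gap 0)" for i
  proof -
    have "sqrt (2 * gap i / \<mu>) = sqrt (2 * gap 0 / \<mu>) * sqrt (gap i / gap 0)"
      using gap_pos[of 0] by (simp flip: real_sqrt_mult)
    then show ?thesis by (simp add: C_def hessian_spread_def gap_def)
  qed
  have "(\<Sum>i<k. C i) \<le> C 0 * (Psi ((1 / L) *\<^sub>R B 0) + 1 / (1 - r))"
  proof (rule sum_le_with_late_geometric_decay[OF r(1,2) _ C_nonneg])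
    show "0 \<le> Psi ((1 / L) *\<^sub>R B 0)"
      using L_pos by (intro Psi_nonneg sym_pos_def_scaleR B0) simp
    have "gap i / gap 0 \<le> 1" for i using gap_antimono[of 0 i] gap_pos[of 0] by simp
    then show "C i \<le> C 0" for i
      using C_nonneg[of 0] by (subst C_gap) (simp add: mult_left_le)
    show "C i \<le> C 0 * r ^ i" if "i \<ge> 1" "real i \<ge> Psi ((1 / L) *\<^sub>R B 0)" for i
    proof -
      have "sqrt (gap i / gap 0) \<le> sqrt ((1 - \<rho>) ^ i)"
        unfolding \<rho>_def by (intro real_sqrt_le_mono linear_rate_after_Psi that)
      also have "\<dots> = r ^ i" by (simp add: r_def real_sqrt_power)
      finally show ?thesis
        using C_nonneg[of 0] by (subst C_gap) (intro mult_left_mono)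
    qed
  qed
  also have "1 / (1 - r) \<le> 3 * \<kappa> * min (2 * (1 + C 0)) (1 + sqrt \<kappa>)"
  proof -
    \<comment> \<open>The sum of the geometric series with ratio \<open>r\<close> is at most \<open>2 / \<rho>\<close>.\<close>
    have "\<rho> \<le> 2 * (1 - r)"
    proof -
      have "\<rho> = (1 + r) * (1 - r)" using r(3) by (simp add: algebra_simps power2_eq_square)
      also have "\<dots> \<le> 2 * (1 - r)" using r by (intro mult_right_mono) auto
      finally show ?thesis .
    qed
    then have "1 / (1 - r) \<le> 2 / \<rho>" using rho r by (simp add: field_simps)
    also have "\<dots> \<le> 3 * \<kappa> * min (2 * (1 + C 0)) (1 + sqrt \<kappa>)"
    proof -
      have pos: "1 + C 0 > 0" "1 + sqrt \<kappa> > 0" "\<kappa> > 0"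
        using C_nonneg[of 0] kappa_ge_1 by (auto simp: add_pos_nonneg)
      have cancel: "3 * \<kappa> * (2 * a) * (1 / \<kappa> * (1 / a) / 3) = 2" if "a > 0" for a
        using that pos(3) by simp
      have "2 \<le> 3 * \<kappa> * (2 * (1 + C 0)) * (1 / \<kappa> * (1 / (1 + C 0)) / 3)"
        by (rule eq_refl, rule cancel[OF pos(1), symmetric])
      also have "\<dots> \<le> 3 * \<kappa> * (2 * (1 + C 0)) * \<rho>"
        unfolding \<rho>_def gain_def using pos by (intro mult_left_mono divide_right_mono) auto
      finally have 1: "2 \<le> 3 * \<kappa> * (2 * (1 + C 0)) * \<rho>" .
      have "2 \<le> 3 * \<kappa> * (1 + sqrt \<kappa>) * (1 / \<kappa> * (2 / (1 + sqrt \<kappa>)) / 3)"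
        using pos by simp
      also have "\<dots> \<le> 3 * \<kappa> * (1 + sqrt \<kappa>) * \<rho>"
        unfolding \<rho>_def gain_def using pos by (intro mult_left_mono divide_right_mono) auto
      finally have 2: "2 \<le> 3 * \<kappa> * (1 + sqrt \<kappa>) * \<rho>" .
      from 1 2 rho show ?thesis by (simp add: divide_le_eq min_def)
    qed
    finally show ?thesis .
  qed
  finally show ?thesis using C_nonneg[of 0] by (simp add: mult_left_mono)
qed

text \<open>
  The gain is at least \<open>exp (- C i) / \<kappa>\<close>, so relative to \<open>1 / \<kappa>\<close> per step at most a factor
  \<open>exp (Psi B0bar + (\<Sum>i<k. C i))\<close> is lost over \<open>k\<close> steps. The hypothesis on \<open>k\<close> makes this exponent at
  most \<open>k\<close>, which amounts to a factor below \<open>3\<close> per step.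
\<close>

lemma condition_number_rate:
  assumes "k \<ge> 1"
    and k: "real k \<ge> (1 + C 0) * Psi ((1 / L) *\<^sub>R B 0)
      + 3 * C 0 * \<kappa> * min (2 * (1 + C 0)) (1 + sqrt \<kappa>)"
  shows "gap k / gap 0 \<le> (1 - 1 / (3 * \<kappa>)) ^ k"
proof (rule rate[OF assms(1)])
  define \<Psi> where "\<Psi> = Psi ((1 / L) *\<^sub>R B 0)"
  show "0 \<le> 1 / (3 * \<kappa>)" using kappa_ge_1 by simp
  have w: "1 / \<kappa> * exp (- C i) \<le> gain i" for i
  proof -
    have "inverse (exp (C i)) \<le> inverse (1 + C i)"
      using C_nonneg[of i] by (intro le_imp_inverse_le exp_ge_add_one_self) simp
    then have "exp (- C i) \<le> 1 / (1 + C i)"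
      by (simp add: exp_minus inverse_eq_divide)
    then show ?thesis
      unfolding gain_def using kappa_ge_1 by (intro mult_left_mono) auto
  qed
  have "\<Psi> + (\<Sum>i<k. C i) \<le> real k"
    using sum_C_le[of k] k by (simp add: \<Psi>_def algebra_simps)
  then have "(1 / 3) ^ k \<le> exp (- (\<Psi> + (\<Sum>i<k. C i)))"
    by (rule exp_minus_ge_third_power)
  then have "(1 / \<kappa>) ^ k * (1 / 3) ^ k \<le> (1 / \<kappa>) ^ k * exp (- (\<Psi> + (\<Sum>i<k. C i)))"
    using kappa_ge_1 by (intro mult_left_mono) auto
  also have "\<dots> = exp (- \<Psi>) * (\<Prod>i<k. 1 / \<kappa> * exp (- C i))"
    by (simp only: prod.distrib prod_constant card_lessThan exp_sum[symmetric] finite_lessThan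
        sum_negf minus_add_distrib exp_add) simp
  also have "\<dots> \<le> exp (- \<Psi>) * (\<Prod>i<k. gain i)"
    using w kappa_ge_1 by (intro mult_left_mono prod_mono) auto
  finally show "(1 / (3 * \<kappa>)) ^ k \<le> exp (- Psi ((1 / L) *\<^sub>R B 0)) * (\<Prod>i<k. gain i)"
    by (simp add: \<Psi>_def power_divide power_mult_distrib mult_ac)
qed

end

section \<open>Convergence rates\<close>

theorem theorem1:
  fixes f :: "real^'n \<Rightarrow> real"
    and x :: "nat \<Rightarrow> real^'n" and xs :: "real^'n"
    and B :: "nat \<Rightarrow> real^'n^'n" and B0bar :: "real^'n^'n"
    and \<mu> L M \<kappa> C0 :: real
  assumes C2: "twice_continuously_differentiable f"
    and minimizer: "\<forall>z. f xs \<le> f z"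
    and pos: "\<mu> > 0" "L > 0" "M > 0"
    and strong: "strongly_convex \<mu> f"
    and lipschitz: "\<forall>u v. norm (gradient f u - gradient f v) \<le> L * norm (u - v)"
    and hess: "\<forall>z. spectral_norm (hessian f z - hessian f xs) \<le> M * norm (z - xs)"
    and B0: "sym_pos_def (B 0)"
    and bfgs: "bfgs_exact_line_search f x B"
    and nonopt: "\<forall>k. x k \<noteq> xs"
    and kappa: "\<kappa> = L / \<mu>"
    and C0: "C0 = 2 * M / \<mu> powr (3/2) * sqrt (2 * (f (x 0) - f xs))"
    and B0bar: "B0bar = (1 / L) *\<^sub>R B 0"
  shows "(\<forall>k\<ge>1. (f (x k) - f xs) / (f (x 0) - f xs)
             \<le> (1 - exp (- (Psi B0bar / real k)) * (1 / \<kappa>)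
                     * max (2 / (1 + sqrt \<kappa>)) (1 / (1 + C0))) ^ k)
       \<and> (\<forall>k\<ge>1. real k \<ge> Psi B0bar \<longrightarrow>
            (f (x k) - f xs) / (f (x 0) - f xs)
             \<le> (1 - 1 / (3 * \<kappa>) * max (2 / (1 + sqrt \<kappa>)) (1 / (1 + C0))) ^ k)
       \<and> (\<forall>k\<ge>1. real k \<ge> (1 + C0) * Psi B0bar
                           + 3 * C0 * \<kappa> * min (2 * (1 + C0)) (1 + sqrt \<kappa>) \<longrightarrow>
            (f (x k) - f xs) / (f (x 0) - f xs) \<le> (1 - 1 / (3 * \<kappa>)) ^ k)"
proof -
  interpret bfgs_iteration f \<mu> L M xs x B
    by unfold_locales (fact assms)+
  have kap: "bfgs_iteration.\<kappa> \<mu> L = \<kappa>" by (simp add: \<kappa>_def kappa)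
  \<comment> \<open>The two expressions for the constant differ in how the power of \<open>\<mu>\<close> is written.\<close>
  have "\<mu> powr (3/2) = \<mu> powr (1 + 1/2)" by simp
  also have "\<dots> = \<mu> * sqrt \<mu>" using pos by (simp only: powr_add powr_half_sqrt) simp
  finally have C: "C 0 = C0"
    by (simp add: C_def hessian_spread_def C0 real_sqrt_divide)
  have gain0: "gain 0 = 1 / \<kappa> * max (2 / (1 + sqrt \<kappa>)) (1 / (1 + C0))"
    by (simp add: gain_def kap C)
  then have gain0_third: "gain 0 / 3 = 1 / (3 * \<kappa>) * max (2 / (1 + sqrt \<kappa>)) (1 / (1 + C0))"
    by simp
  show ?thesis
    using linear_rate linear_rate_after_Psi condition_number_rate
    unfolding B0bar gap_def kap C gain0_third unfolding gain0 mult.assoc by blast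
qed

end
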